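(* Let $h>0$, $r>0$ and let $k\ge 1$ be an integer. Consider the Ricker equation with delay and stocking $$x_{n+1}=x_n\exp(r-x_{n-k})+h,\qquad n\ge0,$$ with initial conditions $x_0,x_{-1},\ldots,x_{-k}\ge0$, and let $\bar x_h$ be its unique positive equilibrium (the unique positive solution of $x=xe^{r-x}+h$). Let $$r_\infty=\frac12\left(h+\sqrt{4h+h^2}\right)+\ln\left(1-\frac{2h}{h+\sqrt{4h+h^2}}\right).$$ If $r<r_\infty$, then the equilibrium $\bar x_h$ is a global attractor, for any finite delay $k$.
   Context: The equilibrium $\bar x_h$ is a global attractor if every solution with nonnegative initial conditions converges to $\bar x_h$. *)

theory Defs
  imports Complex_Main
begin

definition ricker_pos_equilibrium :: "real \<Rightarrow> real \<Rightarrow> real \<Rightarrow> bool" where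
  "ricker_pos_equilibrium r h x \<longleftrightarrow> x > 0 \<and> x = x * exp (r - x) + h"

lemma ricker_pos_equilibrium_iff:
  assumes "h > 0"
  shows "ricker_pos_equilibrium r h x \<longleftrightarrow> x > h \<and> x + ln (1 - h / x) = r"
proof
  assume "ricker_pos_equilibrium r h x"
  then have x: "x > 0" and e: "x = x * exp (r - x) + h"
    by (auto simp: ricker_pos_equilibrium_def)
  have "x * exp (r - x) > 0" using x by simp
  then have "x > h" using e by linarith
  have "1 - h / x = exp (r - x)" using x e by (simp add: field_simps)
  then show "x > h \<and> x + ln (1 - h / x) = r" using \<open>x > h\<close> by simp
next
  assume a: "x > h \<and> x + ln (1 - h / x) = r"
  then have x: "x > 0" using assms by linarith
  have "1 - h / x > 0" using a x by simp
  moreover have "r - x = ln (1 - h / x)" using a by simp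
  ultimately have "exp (r - x) = 1 - h / x" by simp
  then have "x * exp (r - x) + h = x" using x by (simp add: field_simps)
  then show "ricker_pos_equilibrium r h x"
    using x by (simp add: ricker_pos_equilibrium_def)
qed

theorem ricker_pos_equilibrium_ex1:
  assumes h: "h > 0"
  shows "\<exists>!x. ricker_pos_equilibrium r h x"
proof (rule ex_ex1I)
  let ?f = "\<lambda>x. x - x * exp (r - x) - h"
  define b where "b = max r 0 + h / (1 - exp (- h)) + h"
  have q: "0 < 1 - exp (- h)" using h by simp
  then have hq: "h / (1 - exp (- h)) > 0" using h by simp
  have b: "b > 0" "b \<ge> r + h" "b \<ge> h / (1 - exp (- h))"
    using h hq max.cobounded1[of r 0] max.cobounded2[of 0 r] unfolding b_def by linarith+
  have "exp (r - b) \<le> exp (- h)" using b by simp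
  then have "b * exp (r - b) \<le> b * exp (- h)" using b by (intro mult_left_mono) auto
  moreover have "h \<le> b * (1 - exp (- h))" using b(3) q by (simp add: field_simps)
  ultimately have "?f b \<ge> 0" by (simp add: algebra_simps)
  moreover have "?f 0 \<le> 0" using h by simp
  moreover have "continuous_on {0..b} ?f" by (intro continuous_intros)
  ultimately obtain x where x: "0 \<le> x" "?f x = 0"
    using IVT'[of ?f 0 0 b] b(1) by auto
  then have "x \<noteq> 0" using h by auto
  then show "\<exists>x. ricker_pos_equilibrium r h x"
    using x by (intro exI[of _ x]) (simp add: ricker_pos_equilibrium_def)
next
  fix x y assume a: "ricker_pos_equilibrium r h x" "ricker_pos_equilibrium r h y"
  have *: False if "h < u" "u < v" "u + ln (1 - h / u) = r" "v + ln (1 - h / v) = r" for u v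
  proof -
    have u: "u > 0" using that h by linarith
    have "h / v < h / u" using that u h by (simp add: frac_less2)
    moreover have "1 - h / u > 0" using that u by simp
    ultimately have "ln (1 - h / u) < ln (1 - h / v)" by simp
    then show False using that by linarith
  qed
  show "x = y"
    using *[of x y] *[of y x] a ricker_pos_equilibrium_iff[OF h] by (meson linorder_neqE_linordered_idom)
qed

definition ricker_equilibrium :: "real \<Rightarrow> real \<Rightarrow> real" where
  "ricker_equilibrium r h = (THE x. ricker_pos_equilibrium r h x)"

lemma ricker_equilibrium:
  "h > 0 \<Longrightarrow> ricker_pos_equilibrium r h (ricker_equilibrium r h)"
  unfolding ricker_equilibrium_def by (rule theI', rule ricker_pos_equilibrium_ex1)

text \<open>Solutions are indexed by the integers, to accommodate the initial conditions
  at times \<open>-k, \<dots>, 0\<close>; the values at times below \<open>-k\<close> are irrelevant.\<close>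

definition ricker_solution :: "real \<Rightarrow> real \<Rightarrow> nat \<Rightarrow> (int \<Rightarrow> real) \<Rightarrow> bool" where
  "ricker_solution r h k x \<longleftrightarrow>
     (\<forall>n\<ge>0. x (n + 1) = x n * exp (r - x (n - int k)) + h)"

definition ricker_global_attractor :: "real \<Rightarrow> real \<Rightarrow> nat \<Rightarrow> real \<Rightarrow> bool" where
  "ricker_global_attractor r h k c \<longleftrightarrow>
     (\<forall>x. ricker_solution r h k x \<longrightarrow> (\<forall>n\<in>{- int k..0}. x n \<ge> 0) \<longrightarrow>
       (\<lambda>n::nat. x (int n)) \<longlonglongrightarrow> c)"

definition r_infinity :: "real \<Rightarrow> real" where
  "r_infinity h =
     1 / 2 * (h + sqrt (4 * h + h\<^sup>2)) + ln (1 - 2 * h / (h + sqrt (4 * h + h\<^sup>2)))"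

end

theory Submission
  imports Defs
begin

text \<open>
  The hypothesis \<open>r < r_infinity h\<close> says that the equilibrium \<open>c\<close> satisfies \<open>c * (c - h) < h\<close>, which
  is local stability for every delay; it also forces \<open>r < h\<close>. Every solution is eventually at least
  \<open>h > r\<close>, so it is bounded, and its lower and upper limits \<open>L \<le> U\<close> satisfy \<open>U \<le> F L\<close> and
  \<open>F U \<le> L\<close>, where \<open>F y = h / (1 - exp (r - y))\<close>. In the variable \<open>s = (y - r) / 2\<close> the map \<open>F\<close>
  becomes \<open>a + p * coth s\<close>, with \<open>p < sinh\<^sup>2 s\<close> at the fixed point. If \<open>L < U\<close>, then the fixed point lies
  at distances \<open>d, e > 0\<close> from the two limits, and the addition theorem for \<open>coth\<close> yields
  \<open>coth d + coth e < 1 / d + 1 / e\<close>, which contradicts \<open>tanh x < x\<close>.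
\<close>

section \<open>Two-cycles of a decreasing \<open>coth\<close> map\<close>

lemma sinh_less_mult_cosh:
  fixes x :: real
  assumes "x > 0"
  shows "sinh x < x * cosh x"
proof -
  have "0 * cosh 0 - sinh 0 < x * cosh x - sinh x"
  proof (rule DERIV_pos_imp_increasing_open[OF assms])
    fix t :: real assume "0 < t" "t < x"
    then show "\<exists>y. ((\<lambda>x. x * cosh x - sinh x) has_real_derivative y) (at t) \<and> 0 < y"
      by (intro exI[of _ "t * sinh t"]) (auto intro!: derivative_eq_intros)
  qed (intro continuous_intros)
  then show ?thesis by simp
qed

lemma coth_diff:
  fixes x y :: real
  assumes "x > 0" "y > 0"
  shows "cosh x / sinh x - cosh y / sinh y = sinh (y - x) / (sinh x * sinh y)"
proof -
  have "sinh x > 0" "sinh y > 0" using assms by simp_all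
  then show ?thesis by (simp add: sinh_diff field_simps)
qed

lemma coth_antimono:
  fixes x y :: real
  assumes "0 < x" "x \<le> y"
  shows "cosh y / sinh y \<le> cosh x / sinh x"
proof -
  have "sinh (y - x) / (sinh x * sinh y) \<ge> 0" using assms by simp
  moreover have "y > 0" using assms by simp
  ultimately show ?thesis using coth_diff[OF assms(1), of y] by linarith
qed

text \<open>Inequalities replace the equations of a two-cycle, because lower and upper limits of a
  solution satisfy no more than these. The derivative of the map at its fixed point is -p / sinh^2
  s, so \<open>stable\<close> says that it exceeds -1.\<close>

lemma coth_two_cycle_trivial:
  fixes a p s u v :: real
  assumes "p > 0" and stable: "p < (sinh s)\<^sup>2" and pos: "0 < s" "0 < u" and "u \<le> v"
    and fix_s: "s = a + p * (cosh s / sinh s)"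
    and v: "v \<le> a + p * (cosh u / sinh u)" and u: "a + p * (cosh v / sinh v) \<le> u"
  shows "u = s" "v = s"
proof -
  have "v > 0" using assms by simp
  have antimono: "p * (cosh y / sinh y) \<le> p * (cosh x / sinh x)" if "0 < x" "x \<le> y" for x y
    using coth_antimono[OF that] \<open>p > 0\<close> by (intro mult_left_mono) auto
  have "\<not> u < s"
  proof
    assume "u < s"
    \<comment> \<open>If v \<le> s, antitonicity would give u \<ge> a + p * coth v \<ge> a + p *
      coth s = s.\<close>
    then have "s < v"
      using antimono[of v s] u fix_s \<open>v > 0\<close> by linarith
    define d where "d = s - u"
    define e where "e = v - s"
    have de: "d > 0" "e > 0" using \<open>u < s\<close> \<open>s < v\<close> by (simp_all add: d_def e_def)
    have sh: "sinh s > 0" "sinh u > 0" "sinh v > 0" "sinh d > 0" "sinh e > 0"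
      using pos \<open>v > 0\<close> de by simp_all
    have "e \<le> p * (cosh u / sinh u - cosh s / sinh s)"
      using v fix_s by (simp add: e_def algebra_simps)
    also have "\<dots> = p * (sinh d / (sinh u * sinh s))"
      using coth_diff[of u s] pos by (simp add: d_def)
    also have "\<dots> < (sinh s)\<^sup>2 * (sinh d / (sinh u * sinh s))"
      using stable sh by (intro mult_strict_right_mono) auto
    also have "\<dots> = sinh s * sinh d / sinh u"
      using sh by (simp add: power2_eq_square)
    finally have e_less: "sinh u / (sinh s * sinh d) < 1 / e"
      using de sh by (simp add: field_simps)
    \<comment> \<open>The bounds on \<open>d\<close> and \<open>e\<close> are inverted so that they
      can be added: \<open>coth s\<close> enters here with a minus sign and in \<open>v_eq\<close>
      with a plus sign, so it cancels.\<close>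
    have u_eq: "sinh u / (sinh s * sinh d) = cosh d / sinh d - cosh s / sinh s"
      using coth_diff[of d s] de pos by (simp add: d_def mult.commute)
    have "d \<le> p * (cosh s / sinh s - cosh v / sinh v)"
      using u fix_s by (simp add: d_def algebra_simps)
    also have "\<dots> = p * (sinh e / (sinh s * sinh v))"
      using coth_diff[of s v] pos \<open>v > 0\<close> by (simp add: e_def)
    also have "\<dots> < (sinh s)\<^sup>2 * (sinh e / (sinh s * sinh v))"
      using stable sh by (intro mult_strict_right_mono) auto
    also have "\<dots> = sinh s * sinh e / sinh v"
      using sh by (simp add: power2_eq_square)
    finally have d_less: "sinh v / (sinh s * sinh e) < 1 / d"
      using de sh by (simp add: field_simps)
    have v_eq: "sinh v / (sinh s * sinh e) = cosh e / sinh e + cosh s / sinh s"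
    proof -
      have "sinh v = sinh (s + e)" by (simp add: e_def)
      then show ?thesis using sh by (simp add: sinh_add field_simps)
    qed
    have "1 / x < cosh x / sinh x" if "x > 0" for x :: real
      using sinh_less_mult_cosh[OF that] that by (simp add: field_simps)
    from this[OF de(1)] this[OF de(2)] have "1 / d + 1 / e < cosh d / sinh d + cosh e / sinh e"
      by linarith
    then show False using e_less u_eq d_less v_eq by linarith
  qed
  moreover from this have "v \<le> s"
    using antimono[of s u] v fix_s pos by linarith
  ultimately show "u = s" "v = s" using \<open>u \<le> v\<close> by auto
qed

section \<open>Lower and upper limits of a bounded sequence\<close>

lemma eventually_bounded_limits:
  fixes y :: "nat \<Rightarrow> real"
  assumes lb: "eventually (\<lambda>n. a \<le> y n) sequentially"
    and ub: "eventually (\<lambda>n. y n \<le> b) sequentially"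
  obtains L U where "a \<le> L" "L \<le> U"
    and "\<And>l. l < L \<Longrightarrow> eventually (\<lambda>n. l < y n) sequentially"
    and "\<And>u. U < u \<Longrightarrow> eventually (\<lambda>n. y n < u) sequentially"
    and "\<And>l. eventually (\<lambda>n. l \<le> y n) sequentially \<Longrightarrow> l \<le> L"
    and "\<And>u. eventually (\<lambda>n. y n \<le> u) sequentially \<Longrightarrow> U \<le> u"
proof -
  \<comment> \<open>The lower limit is the supremum of the eventual lower bounds, the upper limit
    the infimum of the eventual upper bounds. Each set is bounded by any member of the other, so
    both limits are real.\<close>
  define A where "A = {l. eventually (\<lambda>n. l \<le> y n) sequentially}"
  define B where "B = {u. eventually (\<lambda>n. y n \<le> u) sequentially}"
  have le: "l \<le> u" if "l \<in> A" "u \<in> B" for l u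
  proof -
    have "eventually (\<lambda>n. l \<le> y n \<and> y n \<le> u) sequentially"
      using that by (simp add: A_def B_def eventually_conj_iff)
    then obtain n where "l \<le> y n" "y n \<le> u" by (auto simp: eventually_sequentially)
    then show ?thesis by linarith
  qed
  have mem: "a \<in> A" "b \<in> B" using lb ub by (simp_all add: A_def B_def)
  then have ne: "A \<noteq> {}" "B \<noteq> {}" by auto
  have bdd: "bdd_above A" "bdd_below B"
    using le mem by (auto intro!: bdd_aboveI[of _ b] bdd_belowI[of _ a])
  show ?thesis
  proof
    show "a \<le> Sup A" using mem bdd by (intro cSup_upper)
    show "Sup A \<le> Inf B" using mem le by (intro cSup_least cInf_greatest) auto
    show "eventually (\<lambda>n. l < y n) sequentially" if l: "l < Sup A" for l
    proof -
      obtain m where "m \<in> A" "l < m" using less_cSupD[OF ne(1) l] by blast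
      then show ?thesis by (auto simp: A_def elim: eventually_mono)
    qed
    show "eventually (\<lambda>n. y n < u) sequentially" if u: "Inf B < u" for u
    proof -
      obtain m where "m \<in> B" "m < u" using cInf_lessD[OF ne(2) u] by blast
      then show ?thesis by (auto simp: B_def elim: eventually_mono)
    qed
    show "l \<le> Sup A" if "eventually (\<lambda>n. l \<le> y n) sequentially" for l
      using that bdd by (intro cSup_upper) (auto simp: A_def)
    show "Inf B \<le> u" if "eventually (\<lambda>n. y n \<le> u) sequentially" for u
      using that bdd by (intro cInf_lower) (auto simp: B_def)
  qed
qed

section \<open>Stability of the equilibrium and reduction to \<open>coth\<close>\<close>

lemma r_infinity_bounds:
  assumes h: "h > 0" and r: "r < r_infinity h" and c: "ricker_pos_equilibrium r h c"
  shows "r < h" "c * (c - h) < h"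
proof -
  define w where "w = sqrt (4 * h + h\<^sup>2)"
  \<comment> \<open>\<open>X\<close> is the positive root of X * (X - h) = h, and
    \<open>r_infinity h\<close> is the parameter for which \<open>X\<close> is the equilibrium. As x
    + ln (1 - h / x) increases for x > h, a smaller \<open>r\<close> has its equilibrium below
    \<open>X\<close>.\<close>
  define X where "X = (h + w) / 2"
  have sq: "w > h"
    unfolding w_def using h by (intro real_less_rsqrt) auto
  have X: "X > h" "X > 0" using sq h by (simp_all add: X_def)
  have "2 * X - h = w" unfolding X_def by argo
  then have "(2 * X - h)\<^sup>2 = 4 * h + h\<^sup>2" using h by (simp add: w_def)
  then have X2: "X\<^sup>2 = h * X + h"
    by (simp add: power2_eq_square algebra_simps)
  have "r_infinity h = X + ln (1 - h / X)"
    unfolding r_infinity_def X_def w_def[symmetric] using sq h by (simp add: field_simps)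
  then have rX: "r < X + ln (1 - h / X)" using r by simp
  \<comment> \<open>In this form the estimate ln t \<le> t - 1 at t = 1 / (X + 1) bounds
    \<open>r_infinity h\<close> by exactly \<open>h\<close>.\<close>
  have h_eq: "h = X - 1 + 1 / (X + 1)"
    using X X2 by (simp add: field_simps power2_eq_square)
  have "1 - h / X = 1 / (X + 1)"
    using X X2 by (simp add: field_simps power2_eq_square)
  moreover have "ln (1 / (X + 1)) \<le> 1 / (X + 1) - 1"
    using X by (intro ln_le_minus_one) auto
  ultimately show "r < h" using rX h_eq by simp
  have c': "c > h" "c + ln (1 - h / c) = r"
    using c ricker_pos_equilibrium_iff[OF h] by auto
  have "c < X"
  proof (rule ccontr)
    assume "\<not> c < X"
    then have "h / c \<le> h / X" using X h by (intro divide_left_mono) auto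
    moreover have "1 - h / X > 0" using X by simp
    ultimately have "ln (1 - h / X) \<le> ln (1 - h / c)" by simp
    then show False using rX c' \<open>\<not> c < X\<close> by linarith
  qed
  \<comment> \<open>The product expands to c * (c - h) - X * (X - h), and X * (X - h) = h.\<close>
  then have "(c - X) * (c + X - h) < 0"
    using c' X by (intro mult_neg_pos) auto
  then show "c * (c - h) < h"
    using X2 by (simp add: power2_eq_square algebra_simps)
qed

text \<open>Since r < y, the coefficient 1 - exp (r - y) is positive and both inequalities can be
  solved for \<open>x\<close>. The threshold is h / (1 - exp (-2 * s)) = h * exp s / (2 * sinh
  s).\<close>

lemma stocking_step_iff_coth:
  fixes r h x y :: real
  assumes "r < y"
  defines "s \<equiv> (y - r) / 2"
  shows "x \<le> x * exp (r - y) + h \<longleftrightarrow> x \<le> h / 2 + h / 2 * (cosh s / sinh s)"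
    and "x * exp (r - y) + h \<le> x \<longleftrightarrow> h / 2 + h / 2 * (cosh s / sinh s) \<le> x"
proof -
  have s: "sinh s > 0" using assms by simp
  have "exp (r - y) = exp (- s) * exp (- s)"
    by (simp add: s_def flip: exp_add)
  also have "exp (- s) * exp (- s) = 1 - 2 * sinh s * exp (- s)"
    by (simp add: sinh_def algebra_simps flip: exp_add)
  finally have E: "exp (r - y) = 1 - 2 * sinh s / exp s"
    by (simp add: exp_minus field_simps)
  have C: "h / 2 + h / 2 * (cosh s / sinh s) = h * exp s / (2 * sinh s)"
    using s by (simp add: field_simps flip: sinh_plus_cosh)
  show "x \<le> x * exp (r - y) + h \<longleftrightarrow> x \<le> h / 2 + h / 2 * (cosh s / sinh s)"
    unfolding C E using s by (simp add: field_simps)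
  show "x * exp (r - y) + h \<le> x \<longleftrightarrow> h / 2 + h / 2 * (cosh s / sinh s) \<le> x"
    unfolding C E using s by (simp add: field_simps)
qed

lemma ricker_two_cycle_trivial:
  assumes h: "h > 0" and r: "r < h" and c: "ricker_pos_equilibrium r h c"
    and stable: "c * (c - h) < h" and "h \<le> L" "L \<le> U"
    and U: "U \<le> U * exp (r - L) + h" and L: "L * exp (r - U) + h \<le> L"
  shows "L = c" "U = c"
proof -
  have "c > h" using c ricker_pos_equilibrium_iff[OF h] by auto
  have c_eq: "c * exp (r - c) + h = c" using c by (simp add: ricker_pos_equilibrium_def)
  define s where "s = (c - r) / 2"
  define u where "u = (L - r) / 2"
  define v where "v = (U - r) / 2"
  \<comment> \<open>Conjugating y \<mapsto> h / 2 + h / 2 * coth ((y - r) / 2) by y \<mapsto> (y -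
    r) / 2 gives this constant and the coefficient h / 4.\<close>
  define a where "a = (h / 2 - r) / 2"
  have "c = h / 2 + h / 2 * (cosh s / sinh s)"
    using stocking_step_iff_coth[of r c c h, folded s_def] c_eq \<open>c > h\<close> r
    by (intro antisym) auto
  then have "s = a + h / 4 * (cosh s / sinh s)"
    using s_def a_def by argo
  moreover have "U \<le> h / 2 + h / 2 * (cosh u / sinh u)"
    using stocking_step_iff_coth(1)[of r L U h, folded u_def] U assms by linarith
  then have "v \<le> a + h / 4 * (cosh u / sinh u)"
    using v_def a_def by argo
  moreover have "h / 2 + h / 2 * (cosh v / sinh v) \<le> L"
    using stocking_step_iff_coth(2)[of r U L h, folded v_def] L assms by linarith
  then have "a + h / 4 * (cosh v / sinh v) \<le> u"
    using u_def a_def by argo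
  \<comment> \<open>By the equilibrium equation, 4 * sinh^2 s = h^2 / (c * (c - h)), so the claim is
    \<open>stable\<close> in the new variable.\<close>
  moreover have "h / 4 < (sinh s)\<^sup>2"
  proof -
    have e: "exp (r - c) = (c - h) / c" using c_eq \<open>c > h\<close> h by (simp add: field_simps)
    have "4 * (sinh s)\<^sup>2 = exp (c - r) + exp (r - c) - 2"
    proof -
      have "exp (c - r) = exp s * exp s" "exp (r - c) = exp (- s) * exp (- s)"
        by (simp_all add: s_def flip: exp_add)
      moreover have "exp s * exp (- s) = 1" by (simp flip: exp_add)
      ultimately show ?thesis
        by (simp add: sinh_def power2_eq_square algebra_simps)
    qed
    also have "exp (c - r) = inverse (exp (r - c))" by (simp flip: exp_minus)
    also have "inverse (exp (r - c)) + exp (r - c) - 2 = h\<^sup>2 / (c * (c - h))"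
      using \<open>c > h\<close> h by (simp add: e field_simps power2_eq_square)
    also have "\<dots> > h"
      using mult_strict_left_mono[OF stable h] \<open>c > h\<close> h
      by (simp add: pos_less_divide_eq power2_eq_square)
    finally show ?thesis by simp
  qed
  ultimately have "u = s" "v = s"
    using coth_two_cycle_trivial[of "h / 4" s u v a] assms \<open>c > h\<close>
    by (simp_all add: s_def u_def v_def)
  then show "L = c" "U = c" by (simp_all add: s_def u_def v_def)
qed

section \<open>Boundedness and convergence of solutions\<close>

lemma ricker_eventually_bounded:
  fixes y :: "nat \<Rightarrow> real"
  assumes h: "h > 0" and r: "r < h" and lb: "\<And>n. h \<le> y n"
    and rec: "\<And>n. n \<ge> k \<Longrightarrow> y (Suc n) = y n * exp (r - y (n - k)) + h"
  obtains b where "eventually (\<lambda>n. y n \<le> b) sequentially"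
proof -
  \<comment> \<open>As all values are at least \<open>h\<close>, every growth factor is at most q <
    1. The map t \<mapsto> q * t + h sends any bound b \<ge> h / (1 - q) to at most itself;
    \<open>y k\<close> is included in \<open>b\<close> to start the induction.\<close>
  define q where "q = exp (r - h)"
  have q: "q < 1" using r by (simp add: q_def)
  define b where "b = max (y k) (h / (1 - q))"
  have b: "b * q + h \<le> b"
  proof -
    have "h / (1 - q) \<le> b" by (simp add: b_def)
    then show ?thesis using q by (simp add: field_simps)
  qed
  have "y n \<le> b" if "n \<ge> k" for n
    using that
  proof (induction n rule: dec_induct)
    case base
    then show ?case by (simp add: b_def)
  next
    case (step n)
    have "y n * exp (r - y (n - k)) \<le> b * q"
      using step lb[of n] lb[of "n - k"] h unfolding q_def by (intro mult_mono) auto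
    then show ?case using rec[of n] step b by simp
  qed
  then show ?thesis using that by (auto simp: eventually_sequentially)
qed

text \<open>The right-hand side increases in the current value and decreases in the delayed one.
  Eventually both lie between L - e and U + e, whatever the delay, so the next value is bounded by
  the two extreme combinations.\<close>

lemma ricker_limit:
  fixes y :: "nat \<Rightarrow> real"
  assumes h: "h > 0" and r: "r < h" and c: "ricker_pos_equilibrium r h c"
    and stable: "c * (c - h) < h" and lb: "\<And>n. h \<le> y n"
    and rec: "\<And>n. n \<ge> k \<Longrightarrow> y (Suc n) = y n * exp (r - y (n - k)) + h"
  shows "y \<longlonglongrightarrow> c"
proof -
  obtain b where "eventually (\<lambda>n. y n \<le> b) sequentially"
    using ricker_eventually_bounded[OF h r lb rec] .
  then obtain L U where LU: "h \<le> L" "L \<le> U"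
    and L_less: "\<And>l. l < L \<Longrightarrow> eventually (\<lambda>n. l < y n) sequentially"
    and U_gr: "\<And>u. U < u \<Longrightarrow> eventually (\<lambda>n. y n < u) sequentially"
    and L_ge: "\<And>l. eventually (\<lambda>n. l \<le> y n) sequentially \<Longrightarrow> l \<le> L"
    and U_le: "\<And>u. eventually (\<lambda>n. y n \<le> u) sequentially \<Longrightarrow> U \<le> u"
    using eventually_bounded_limits[of h y b] lb by auto
  have approx: "U \<le> (U + e) * exp (r - (L - e)) + h" "(L - e) * exp (r - (U + e)) + h \<le> L"
    if "e > 0" for e
  proof -
    have "eventually (\<lambda>n. L - e < y n \<and> y n < U + e) sequentially"
      using L_less[of "L - e"] U_gr[of "U + e"] that by (simp add: eventually_conj_iff)
    then obtain N where N: "\<And>n. n \<ge> N \<Longrightarrow> L - e < y n \<and> y n < U + e"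
      by (auto simp: eventually_sequentially)
    have step: "y (Suc n) \<le> (U + e) * exp (r - (L - e)) + h"
      "(L - e) * exp (r - (U + e)) + h \<le> y (Suc n)" if n: "n \<ge> N + k" for n
    proof -
      have nk: "n - k \<ge> N" "n \<ge> N" "n \<ge> k" using n by auto
      note * = N[OF nk(1)] N[OF nk(2)] and pos = lb[of n] h
      have "y n * exp (r - y (n - k)) \<le> (U + e) * exp (r - (L - e))"
        using * pos by (intro mult_mono) auto
      then show "y (Suc n) \<le> (U + e) * exp (r - (L - e)) + h" using rec[OF nk(3)] by simp
      have "(L - e) * exp (r - (U + e)) \<le> y n * exp (r - (U + e))"
        using * by (intro mult_right_mono) auto
      also have "\<dots> \<le> y n * exp (r - y (n - k))"
        using * pos by (intro mult_left_mono) auto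
      finally show "(L - e) * exp (r - (U + e)) + h \<le> y (Suc n)" using rec[OF nk(3)] by simp
    qed
    have shift: "eventually P sequentially" if "\<And>n. n \<ge> N + k \<Longrightarrow> P (Suc n)" for P
    proof -
      have "eventually (\<lambda>n. P (Suc n)) sequentially"
        unfolding eventually_sequentially using that by blast
      then show ?thesis by (rule iffD1[OF eventually_sequentially_Suc])
    qed
    show "U \<le> (U + e) * exp (r - (L - e)) + h" by (intro U_le shift step)
    show "(L - e) * exp (r - (U + e)) + h \<le> L" by (intro L_ge shift step)
  qed
  \<comment> \<open>Letting \<open>e\<close> tend to 0 from the right removes the slack from
    \<open>approx\<close>, which leaves the two inequalities between \<open>L\<close> and
    \<open>U\<close>.\<close>
  have "((\<lambda>e. (U + e) * exp (r - (L - e)) + h) \<longlongrightarrow> (U + 0) * exp (r - (L - 0)) + h) (at_right 0)"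
    by (intro tendsto_intros)
  then have "U \<le> (U + 0) * exp (r - (L - 0)) + h"
    by (rule tendsto_lowerbound) (auto simp: eventually_at_filter intro!: always_eventually approx)
  moreover have "((\<lambda>e. (L - e) * exp (r - (U + e)) + h) \<longlongrightarrow> (L - 0) * exp (r - (U + 0)) + h) (at_right 0)"
    by (intro tendsto_intros)
  then have "(L - 0) * exp (r - (U + 0)) + h \<le> L"
    by (rule tendsto_upperbound) (auto simp: eventually_at_filter intro!: always_eventually approx)
  ultimately have "L = c" "U = c"
    using ricker_two_cycle_trivial[OF h r c stable LU] by simp_all
  then show ?thesis using L_less U_gr by (auto intro: order_tendstoI)
qed

theorem corollary4p1:
  fixes h r :: real and k :: nat
  assumes "h > 0" and "r > 0" and "k \<ge> 1"
    and "r < r_infinity h"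
  shows "ricker_global_attractor r h k (ricker_equilibrium r h)"
  unfolding ricker_global_attractor_def
proof (intro allI impI)
  fix x assume sol: "ricker_solution r h k x" and init: "\<forall>n\<in>{- int k..0}. x n \<ge> 0"
  note c = ricker_equilibrium[OF \<open>h > 0\<close>, of r]
  have rec: "x (int n + 1) = x (int n) * exp (r - x (int n - int k)) + h" for n
    using sol by (simp add: ricker_solution_def)
  have "x (int n) \<ge> 0" for n
  proof (induction n)
    case 0
    then show ?case using init by simp
  next
    case (Suc n)
    then show ?case using rec[of n] \<open>h > 0\<close> by (simp add: add.commute)
  qed
  then have lb: "h \<le> x (int (Suc n))" for n
    using rec[of n] by (simp add: add.commute)
  \<comment> \<open>The shift by one makes the bound \<open>h\<close> hold from the first term on,
    as \<open>x 0\<close> is only known to be nonnegative. For n \<ge> k the delayed index of the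
    shifted sequence is again a natural number.\<close>
  have "(\<lambda>n. x (int (Suc n))) \<longlonglongrightarrow> ricker_equilibrium r h"
  proof (rule ricker_limit[OF \<open>h > 0\<close> r_infinity_bounds(1)[OF assms(1,4) c] c
        r_infinity_bounds(2)[OF assms(1,4) c] lb])
    fix n assume "n \<ge> k"
    then show "x (int (Suc (Suc n))) = x (int (Suc n)) * exp (r - x (int (Suc (n - k)))) + h"
      using rec[of "Suc n"] by (simp add: of_nat_diff algebra_simps)
  qed
  then show "(\<lambda>n::nat. x (int n)) \<longlonglongrightarrow> ricker_equilibrium r h"
    by (rule LIMSEQ_imp_Suc)
qed

end
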